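(* Let $\mathcal S$ be a locally compact Hausdorff space with Stone-Čech compactification $\widehat{\mathcal S}$, let $\mathfrak B$ be a generative Boolean subalgebra of $\mathfrak R(\mathcal S)$, and let $\mathcal S^*:=\sigma(\mathfrak B)$ be the Stone space of $\mathfrak B$. For any $s^*\in\mathcal S^*$, the intersection $$\bigcap_{B\in s^*}\mathrm{clos}(\widehat B)$$ (closures taken in $\widehat{\mathcal S}$) contains exactly one element, denoted $p(s^* )$. This determines a continuous surjective function $p:\mathcal S^*\to\widehat{\mathcal S}$.
   Context: For a topological space $\mathcal T$, an open set $R\subseteq\mathcal T$ is regular if $R=\mathrm{int}(\mathrm{clos}(R))$. $\mathfrak R(\mathcal T)$ is the set of regular open subsets; it is a Boolean algebra with meet $\cap$, join $Q\vee R:=\mathrm{int}(\mathrm{clos}(Q\cup R))$ and complement $\neg R:=\mathrm{int}(\mathcal T\setminus R)$. A Boolean subalgebra is a subset closed under $\cap,\vee,\neg$. For $\mathcal S$ locally compact Hausdorff, the map $Q\mapsto Q\cap\mathcal S$ is a Boolean algebra isomorphism $\mathfrak R(\widehat{\mathcal S})\to\mathfrak R(\mathcal S)$; for $R\in\mathfrak R(\mathcal S)$, $\widehat R$ denotes the unique element of $\mathfrak R(\widehat{\mathcal S})$ with $\widehat R\cap\mathcal S=R$. Put $\widehat{\mathfrak B}:=\{\widehat B: B\in\mathfrak B\}$. $\mathfrak B$ is generative if $\widehat{\mathfrak B}$ is a base for the topology of $\widehat{\mathcal S}$. The Stone space $\sigma(\mathfrak B)$ is the set of all ultrafilters of the Boolean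 algebra $\mathfrak B$, with the topology having as base the sets $B^*:=\{s^*\in\sigma(\mathfrak B): B\in s^*\}$, $B\in\mathfrak B$. *)

theory Defs
  imports "HOL-Analysis.Analysis"
begin

section \<open>Regular open sets\<close>

definition regular_opens :: "'a topology \<Rightarrow> 'a set set" where
  "regular_opens X = {R. openin X R \<and> R = X interior_of (X closure_of R)}"

definition regular_join :: "'a topology \<Rightarrow> 'a set \<Rightarrow> 'a set \<Rightarrow> 'a set" where
  "regular_join X Q R = X interior_of (X closure_of (Q \<union> R))"

definition regular_compl :: "'a topology \<Rightarrow> 'a set \<Rightarrow> 'a set" where
  "regular_compl X R = X interior_of (topspace X - R)"

text \<open>Non-emptiness is not demanded; a non-empty \<open>\<BB>\<close> contains \<open>{}\<close> and \<open>topspace X\<close>.\<close>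

definition boolean_subalgebra :: "'a topology \<Rightarrow> 'a set set \<Rightarrow> bool" where
  "boolean_subalgebra X \<BB> \<longleftrightarrow> \<BB> \<subseteq> regular_opens X \<and>
     (\<forall>Q\<in>\<BB>. \<forall>R\<in>\<BB>. Q \<inter> R \<in> \<BB>) \<and>
     (\<forall>Q\<in>\<BB>. \<forall>R\<in>\<BB>. regular_join X Q R \<in> \<BB>) \<and>
     (\<forall>R\<in>\<BB>. regular_compl X R \<in> \<BB>)"

section \<open>Stone-Cech compactifications\<close>

text \<open>
  \<open>(T, e)\<close> is a Stone-Cech compactification of \<open>S\<close>: a Hausdorff compactification of \<open>S\<close>
  to which every continuous function into the unit interval extends. Since \<open>S\<close> and \<open>T\<close> live on
  different types, the inclusion of \<open>S\<close> in \<open>T\<close> is the explicit embedding \<open>e\<close>.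
  The lemmas \<open>stone_cech_universal\<close> and \<open>stone_cech_exists\<close> below give the universal
  property for arbitrary compact Hausdorff targets, and existence.
\<close>

definition stone_cech :: "'a topology \<Rightarrow> 'b topology \<Rightarrow> ('a \<Rightarrow> 'b) \<Rightarrow> bool" where
  "stone_cech S T e \<longleftrightarrow> compact_space T \<and> Hausdorff_space T \<and>
     embedding_map S T e \<and> T closure_of (e ` topspace S) = topspace T \<and>
     (\<forall>f. continuous_map S (top_of_set {0..1::real}) f \<longrightarrow>
        (\<exists>g. continuous_map T (top_of_set {0..1::real}) g \<and> (\<forall>x\<in>topspace S. g (e x) = f x)))"

text \<open>\<open>trace_on S e Q\<close> is the set \<open>Q \<inter> S\<close> when \<open>S\<close> is regarded as a subset via \<open>e\<close>.\<close>

definition trace_on :: "'a topology \<Rightarrow> ('a \<Rightarrow> 'b) \<Rightarrow> 'b set \<Rightarrow> 'a set" where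
  "trace_on S e Q = {x \<in> topspace S. e x \<in> Q}"

definition hat :: "'a topology \<Rightarrow> 'b topology \<Rightarrow> ('a \<Rightarrow> 'b) \<Rightarrow> 'a set \<Rightarrow> 'b set" where
  "hat S T e R = (THE Q. Q \<in> regular_opens T \<and> trace_on S e Q = R)"

definition generative :: "'a topology \<Rightarrow> 'b topology \<Rightarrow> ('a \<Rightarrow> 'b) \<Rightarrow> 'a set set \<Rightarrow> bool" where
  "generative S T e \<BB> \<longleftrightarrow> openin T = arbitrary union_of (\<lambda>U. U \<in> hat S T e ` \<BB>)"

section \<open>Stone spaces\<close>

text \<open>In an algebra of regular open sets the order is inclusion and the bottom element is \<open>{}\<close>.
  Ultrafilters are the maximal proper filters.\<close>

definition proper_filter_of :: "'a set set \<Rightarrow> 'a set set \<Rightarrow> bool" where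
  "proper_filter_of \<BB> F \<longleftrightarrow> F \<subseteq> \<BB> \<and> F \<noteq> {} \<and> {} \<notin> F \<and>
     (\<forall>A\<in>F. \<forall>B\<in>F. A \<inter> B \<in> F) \<and> (\<forall>A\<in>F. \<forall>B\<in>\<BB>. A \<subseteq> B \<longrightarrow> B \<in> F)"

definition ultrafilter_of :: "'a set set \<Rightarrow> 'a set set \<Rightarrow> bool" where
  "ultrafilter_of \<BB> F \<longleftrightarrow> proper_filter_of \<BB> F \<and>
     (\<forall>G. proper_filter_of \<BB> G \<longrightarrow> F \<subseteq> G \<longrightarrow> G = F)"

definition stone_basic :: "'a set set \<Rightarrow> 'a set \<Rightarrow> 'a set set set" where
  "stone_basic \<BB> B = {s. ultrafilter_of \<BB> s \<and> B \<in> s}"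

definition stone_space :: "'a set set \<Rightarrow> 'a set set topology" where
  "stone_space \<BB> = topology (arbitrary union_of (\<lambda>U. U \<in> stone_basic \<BB> ` \<BB>))"

section \<open>The limit point of an ultrafilter\<close>

definition limit_set :: "'a topology \<Rightarrow> 'b topology \<Rightarrow> ('a \<Rightarrow> 'b) \<Rightarrow> 'a set set \<Rightarrow> 'b set" where
  "limit_set S T e s = (\<Inter>B\<in>s. T closure_of (hat S T e B))"

definition limit_point :: "'a topology \<Rightarrow> 'b topology \<Rightarrow> ('a \<Rightarrow> 'b) \<Rightarrow> 'a set set \<Rightarrow> 'b" where
  "limit_point S T e s = (THE x. x \<in> limit_set S T e s)"

section \<open>Well-definedness of the notions above\<close>

lemma
  assumes "boolean_subalgebra X \<BB>"
  shows openin_stone_space: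
      "openin (stone_space \<BB>) = arbitrary union_of (\<lambda>U. U \<in> stone_basic \<BB> ` \<BB>)"
    and topspace_stone_space: "topspace (stone_space \<BB>) = {s. ultrafilter_of \<BB> s}"
proof -
  have int: "stone_basic \<BB> A \<inter> stone_basic \<BB> B = stone_basic \<BB> (A \<inter> B)"
    if "A \<in> \<BB>" "B \<in> \<BB>" "A \<inter> B \<in> \<BB>" for A B
    using that by (auto simp: stone_basic_def ultrafilter_of_def proper_filter_of_def
        dest: bspec)
  have "istopology (arbitrary union_of (\<lambda>U. U \<in> stone_basic \<BB> ` \<BB>))"
  proof (rule istopology_base)
    fix U V assume "U \<in> stone_basic \<BB> ` \<BB>" "V \<in> stone_basic \<BB> ` \<BB>"
    then obtain A B where "A \<in> \<BB>" "B \<in> \<BB>" "U = stone_basic \<BB> A" "V = stone_basic \<BB> B"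
      by blast
    moreover have "A \<inter> B \<in> \<BB>"
      using assms calculation unfolding boolean_subalgebra_def by blast
    ultimately show "U \<inter> V \<in> stone_basic \<BB> ` \<BB>"
      using int by blast
  qed
  then show *: "openin (stone_space \<BB>) = arbitrary union_of (\<lambda>U. U \<in> stone_basic \<BB> ` \<BB>)"
    by (simp add: stone_space_def topology_inverse')
  show "topspace (stone_space \<BB>) = {s. ultrafilter_of \<BB> s}"
  proof
    show "topspace (stone_space \<BB>) \<subseteq> {s. ultrafilter_of \<BB> s}"
      unfolding topspace_def * by (auto simp: union_of_def arbitrary_def stone_basic_def)
    show "{s. ultrafilter_of \<BB> s} \<subseteq> topspace (stone_space \<BB>)"
    proof clarify
      fix s assume s: "ultrafilter_of \<BB> s"
      then obtain B where B: "B \<in> s" "B \<in> \<BB>"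
        unfolding ultrafilter_of_def proper_filter_of_def by (meson equals0I subsetD)
      then have "openin (stone_space \<BB>) (stone_basic \<BB> B)"
        unfolding * by (intro arbitrary_union_of_inc) blast
      moreover have "s \<in> stone_basic \<BB> B"
        using s B by (simp add: stone_basic_def)
      ultimately show "s \<in> topspace (stone_space \<BB>)"
        using openin_subset by blast
    qed
  qed
qed

lemma closure_of_open_Int_dense:
  assumes "T closure_of D = topspace T" "openin T U"
  shows "T closure_of (U \<inter> D) = T closure_of U"
proof
  show "T closure_of U \<subseteq> T closure_of (U \<inter> D)"
    using openin_Int_closure_of_subset[OF assms(2), of D] assms openin_subset[OF assms(2)]
    by (metis closure_of_closure_of closure_of_mono inf.absorb1)
qed (simp add: closure_of_mono)

lemma trace_bij_betw:
  assumes e: "embedding_map S T e" and dense: "T closure_of (e ` topspace S) = topspace T"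
  shows "bij_betw (trace_on S e) (regular_opens T) (regular_opens S)"
proof -
  define D where "D = e ` topspace S"
  define X where "X = subtopology T D"
  have hom: "homeomorphic_map S X e"
    using e by (simp add: embedding_map_def X_def D_def)
  have inj: "inj_on e (topspace S)"
    using hom by (simp add: homeomorphic_eq_everything_map)
  have DT: "D \<subseteq> topspace T"
    using dense e D_def by (metis closure_of_subset_topspace embedding_map_def
        homeomorphic_imp_surjective_map inf_le1 topspace_subtopology)
  have img: "e ` trace_on S e Q = Q \<inter> D" for Q
    by (auto simp: trace_on_def D_def)
  have reg: "R \<in> regular_opens S \<longleftrightarrow> e ` R \<in> regular_opens X" if "R \<subseteq> topspace S" for R
  proof -
    have "e ` (S interior_of (S closure_of R)) = X interior_of (X closure_of (e ` R))"
      using homeomorphic_map_interior_of[OF hom] homeomorphic_map_closure_of[OF hom that]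
        closure_of_subset_topspace by metis
    moreover have "openin S R \<longleftrightarrow> openin X (e ` R)"
      using homeomorphic_map_openness[OF hom that] by simp
    moreover have "S interior_of (S closure_of R) \<subseteq> topspace S"
      by (simp add: interior_of_subset_topspace)
    ultimately show ?thesis
      using inj_on_image_eq_iff[OF inj that, of "S interior_of (S closure_of R)"]
      by (simp add: regular_opens_def)
  qed
  have cl: "T closure_of (U \<inter> D) = T closure_of U" if "openin T U" for U
    using closure_of_open_Int_dense dense that D_def by metis
  have sub: "U \<subseteq> T closure_of U" if "openin T U" for U
    using that by (simp add: closure_of_subset openin_subset)
  have clX: "X closure_of A = D \<inter> T closure_of A" if "A \<subseteq> D" for A
    using that by (simp add: X_def closure_of_subtopology inf.absorb2)
  have intX: "W \<subseteq> T interior_of (T closure_of A)"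
    if "openin T W" "W \<inter> D \<subseteq> T closure_of A" for W A
  proof -
    have "W \<subseteq> T closure_of (W \<inter> D)" using sub cl that by auto
    also have "\<dots> \<subseteq> T closure_of A"
      using that by (metis closure_of_closure_of closure_of_mono)
    finally show ?thesis using that by (simp add: interior_of_maximal)
  qed
  have regX: "Q \<inter> D \<in> regular_opens X" if Q: "Q \<in> regular_opens T" for Q
  proof -
    have oQ: "openin T Q" and Qeq: "Q = T interior_of (T closure_of Q)"
      using Q by (auto simp: regular_opens_def)
    have o: "openin X (Q \<inter> D)"
      using oQ by (auto simp: X_def openin_subtopology)
    moreover have "X interior_of (X closure_of (Q \<inter> D)) \<subseteq> Q \<inter> D"
    proof -
      obtain W where W: "openin T W" "X interior_of (X closure_of (Q \<inter> D)) = W \<inter> D"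
        using openin_interior_of[of X] unfolding X_def openin_subtopology by metis
      have "W \<inter> D \<subseteq> X closure_of (Q \<inter> D)"
        using W(2) interior_of_subset by metis
      also have "\<dots> \<subseteq> T closure_of Q"
        using clX[of "Q \<inter> D"] cl[OF oQ] by auto
      finally show ?thesis
        using intX[OF W(1)] Qeq W(2) by blast
    qed
    moreover have "Q \<inter> D \<subseteq> X interior_of (X closure_of (Q \<inter> D))"
      using o by (meson closure_of_subset interior_of_maximal openin_subset)
    ultimately show ?thesis by (auto simp: regular_opens_def)
  qed
  show ?thesis
    unfolding bij_betw_def
  proof
    show "inj_on (trace_on S e) (regular_opens T)"
    proof
      fix P Q assume PQ: "P \<in> regular_opens T" "Q \<in> regular_opens T" "trace_on S e P = trace_on S e Q"
      then have "P \<inter> D = Q \<inter> D" using img by metis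
      then have "T closure_of P = T closure_of Q"
        using PQ cl by (metis (mono_tags, lifting) mem_Collect_eq regular_opens_def)
      then show "P = Q"
        using PQ by (metis (mono_tags, lifting) mem_Collect_eq regular_opens_def)
    qed
    show "trace_on S e ` regular_opens T = regular_opens S"
    proof
      show "trace_on S e ` regular_opens T \<subseteq> regular_opens S"
        using reg regX img by (auto simp: trace_on_def)
      show "regular_opens S \<subseteq> trace_on S e ` regular_opens T"
      proof
        fix R assume R: "R \<in> regular_opens S"
        have RS: "R \<subseteq> topspace S" using R by (simp add: regular_opens_def openin_subset)
        have eR: "e ` R \<in> regular_opens X" using reg RS R by blast
        define Q where "Q = T interior_of (T closure_of (e ` R))"
        have Q: "Q \<in> regular_opens T"
        proof -
          have "T closure_of Q \<subseteq> T closure_of (e ` R)"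
            unfolding Q_def by (simp add: closure_of_minimal interior_of_subset)
          then have "T interior_of (T closure_of Q) \<subseteq> Q"
            unfolding Q_def by (rule interior_of_mono)
          moreover have "openin T Q"
            by (simp add: Q_def)
          ultimately show ?thesis
            using sub[of Q] interior_of_maximal[of Q "T closure_of Q" T]
            by (auto simp: regular_opens_def)
        qed
        have eRD: "e ` R \<subseteq> D" using RS D_def by blast
        have "Q \<inter> D = e ` R"
        proof
          have "Q \<inter> D \<subseteq> X closure_of (e ` R)"
            using clX[OF eRD] interior_of_subset[of T] by (auto simp: Q_def)
          moreover have "openin X (Q \<inter> D)"
            unfolding X_def openin_subtopology Q_def using openin_interior_of by blast
          ultimately show "Q \<inter> D \<subseteq> e ` R"
            using eR interior_of_maximal[of "Q \<inter> D" "X closure_of e ` R" X]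
            by (simp add: regular_opens_def)
          obtain V where V: "openin T V" "e ` R = V \<inter> D"
            using eR by (auto simp: regular_opens_def X_def openin_subtopology)
          then have "V \<inter> D \<subseteq> T closure_of (e ` R)"
            using closure_of_subset[of "e ` R" T] eRD DT by auto
          then show "e ` R \<subseteq> Q \<inter> D"
            using intX[OF V(1)] V(2) Q_def by auto
        qed
        then have "e ` trace_on S e Q = e ` R" using img by simp
        then have "trace_on S e Q = R"
          using inj_on_image_eq_iff[OF inj, of "trace_on S e Q" R] RS by (auto simp: trace_on_def)
        then show "R \<in> trace_on S e ` regular_opens T" using Q by blast
      qed
    qed
  qed
qed

lemma hat_characterization:
  assumes "stone_cech S T e" "R \<in> regular_opens S"
  shows "\<exists>!Q. Q \<in> regular_opens T \<and> trace_on S e Q = R"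
    and "hat S T e R \<in> regular_opens T" and "trace_on S e (hat S T e R) = R"
proof -
  have bij: "bij_betw (trace_on S e) (regular_opens T) (regular_opens S)"
    using assms(1) trace_bij_betw[of S T e] by (simp add: stone_cech_def)
  show ex: "\<exists>!Q. Q \<in> regular_opens T \<and> trace_on S e Q = R"
  proof (rule ex_ex1I)
    have "R \<in> trace_on S e ` regular_opens T"
      using bij_betw_imp_surj_on[OF bij] assms(2) by simp
    then show "\<exists>Q. Q \<in> regular_opens T \<and> trace_on S e Q = R"
      by (auto elim!: imageE)
  next
    fix P Q assume P: "P \<in> regular_opens T \<and> trace_on S e P = R"
      and Q: "Q \<in> regular_opens T \<and> trace_on S e Q = R"
    show "P = Q"
      by (rule inj_onD[OF bij_betw_imp_inj_on[OF bij]]) (use P Q in simp_all)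
  qed
  show "hat S T e R \<in> regular_opens T" "trace_on S e (hat S T e R) = R"
    using theI'[OF ex] by (simp_all add: hat_def)
qed

theorem stone_cech_universal:
  fixes K :: "'c topology"
  assumes sc: "stone_cech S T e" and K: "compact_space K" "Hausdorff_space K"
    and f: "continuous_map S K f"
  shows "\<exists>g. continuous_map T K g \<and> (\<forall>x\<in>topspace S. g (e x) = f x)"
proof -
  let ?I = "top_of_set {0..1::real}"
  have "completely_regular_space K"
    using K by (simp add: compact_Hausdorff_or_regular_imp_normal_space
        compact_imp_locally_compact_space locally_compact_Hausdorff_imp_regular_space
        locally_compact_regular_imp_completely_regular_space)
  then obtain J and h where h: "embedding_map K (product_topology (\<lambda>j::'c \<Rightarrow> real. ?I) J) h"
    using completely_regular_space_cube_embedding K by metis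
  let ?P = "product_topology (\<lambda>j::'c \<Rightarrow> real. ?I) J"
  define H where "H = h ` topspace K"
  have hom: "homeomorphic_map K (subtopology ?P H) h"
    using h by (simp add: embedding_map_def H_def)
  then obtain k where k: "homeomorphic_maps K (subtopology ?P H) h k"
    using homeomorphic_map_maps by blast
  have hc: "continuous_map K ?P h"
    using hom homeomorphic_imp_continuous_map continuous_map_into_fulltopology by blast
  have "Hausdorff_space ?P"
    by (simp add: Hausdorff_space_product_topology Hausdorff_space_subtopology)
  moreover have "compactin ?P H"
    using K hc H_def image_compactin by (metis compact_space_def)
  ultimately have Hcl: "closedin ?P H"
    using compactin_imp_closedin by blast
  have "\<exists>g. continuous_map T ?I g \<and> (\<forall>x\<in>topspace S. g (e x) = h (f x) j)" if "j \<in> J" for j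
  proof -
    have "continuous_map S ?I ((\<lambda>y. y j) \<circ> (h \<circ> f))"
      by (intro continuous_map_compose[OF continuous_map_compose[OF f hc]]
          continuous_map_product_projection that)
    then obtain g where "continuous_map T ?I g"
        "\<forall>x\<in>topspace S. g (e x) = ((\<lambda>y. y j) \<circ> (h \<circ> f)) x"
      using sc unfolding stone_cech_def by meson
    then show ?thesis by auto
  qed
  then obtain G where G: "\<And>j. j \<in> J \<Longrightarrow> continuous_map T ?I (G j)"
      "\<And>j x. j \<in> J \<Longrightarrow> x \<in> topspace S \<Longrightarrow> G j (e x) = h (f x) j"
    by metis
  define g where "g = (\<lambda>t. \<lambda>j\<in>J. G j t)"
  have g: "continuous_map T ?P g"
    using G(1) by (auto simp: continuous_map_componentwise g_def)
  have ge: "g (e x) = h (f x)" if x: "x \<in> topspace S" for x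
  proof -
    have "f x \<in> topspace K"
      using continuous_map_image_subset_topspace[OF f] x by blast
    then have "h (f x) \<in> topspace ?P"
      using continuous_map_image_subset_topspace[OF hc] by blast
    then have "h (f x) \<in> extensional J" by (auto simp: PiE_def)
    then show ?thesis
      using G(2) x by (auto simp: g_def fun_eq_iff extensional_def)
  qed
  have gH: "g t \<in> H" if "t \<in> topspace T" for t
  proof -
    have "g ` (T closure_of (e ` topspace S)) \<subseteq> ?P closure_of (g ` e ` topspace S)"
      using g continuous_map_image_closure_subset by blast
    also have "\<dots> \<subseteq> H"
    proof (rule closure_of_minimal[OF _ Hcl])
      show "g ` e ` topspace S \<subseteq> H"
        using ge f by (auto simp: H_def continuous_map_def Pi_iff)
    qed
    finally show ?thesis using that sc by (auto simp: stone_cech_def)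
  qed
  have "continuous_map T (subtopology ?P H) g"
    using g gH by (auto simp: continuous_map_in_subtopology)
  then have "continuous_map T K (k \<circ> g)"
    using k continuous_map_compose by (auto simp: homeomorphic_maps_def)
  moreover have "(k \<circ> g) (e x) = f x" if x: "x \<in> topspace S" for x
    using ge x k f by (auto simp: homeomorphic_maps_def continuous_map_def Pi_iff)
  ultimately show ?thesis by blast
qed

theorem stone_cech_exists:
  fixes S :: "'a topology"
  assumes "locally_compact_space S" "Hausdorff_space S"
  shows "\<exists>(T :: (('a \<Rightarrow> real) \<Rightarrow> real) topology) e. stone_cech S T e"
proof -
  let ?I = "top_of_set {0..1::real}"
  define J where "J = mspace (submetric (cfunspace S euclidean_metric)
                       {f. f \<in> topspace S \<rightarrow> {0..1::real}})"
  define P where "P = product_topology (\<lambda>f::'a \<Rightarrow> real. ?I) J"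
  define e where "e = (\<lambda>x. \<lambda>f\<in>J. f x)"
  have "completely_regular_space S"
    using assms locally_compact_Hausdorff_imp_regular_space
      locally_compact_regular_imp_completely_regular_space by blast
  then have emb: "embedding_map S P e"
    using completely_regular_space_cube_embedding_explicit assms(2)
    unfolding P_def J_def e_def by blast
  have eP: "e ` topspace S \<subseteq> topspace P"
    using emb unfolding embedding_map_def
    by (metis homeomorphic_imp_surjective_map inf_le1 topspace_subtopology)
  define C where "C = P closure_of (e ` topspace S)"
  define T where "T = subtopology P C"
  have eC: "e ` topspace S \<subseteq> C"
    using eP by (simp add: C_def closure_of_subset)
  have "compact_space P"
    unfolding P_def compact_space_product_topology by (simp add: compact_space_subtopology)
  then have "compact_space T"
    unfolding T_def C_def
    by (simp add: closedin_compact_space compact_space_subtopology)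
  moreover have "Hausdorff_space T"
    by (simp add: T_def P_def Hausdorff_space_product_topology Hausdorff_space_subtopology)
  moreover have "embedding_map S T e"
    using emb eC by (simp add: T_def embedding_map_in_subtopology)
  moreover have "T closure_of (e ` topspace S) = topspace T"
  proof -
    have "C \<inter> e ` topspace S = e ` topspace S" "C \<subseteq> topspace P"
      using eC by (auto simp: C_def closure_of_subset_topspace)
    then show ?thesis
      by (auto simp: T_def closure_of_subtopology simp flip: C_def)
  qed
  moreover have "\<exists>g. continuous_map T ?I g \<and> (\<forall>x\<in>topspace S. g (e x) = f x)"
    if f: "continuous_map S ?I f" for f
  proof -
    define f' where "f' = restrict f (topspace S)"
    have im: "f ` topspace S \<subseteq> {0..1}"
      using f by (auto simp: continuous_map_in_subtopology)
    have "bounded (f' ` topspace S)"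
      by (rule bounded_subset[of "{0..1}"]) (use im in \<open>auto simp: f'_def\<close>)
    moreover have "continuous_map S euclideanreal f'"
      using f unfolding f'_def by (metis continuous_map_in_subtopology continuous_map_eq restrict_apply')
    ultimately have "f' \<in> J"
      using im by (auto simp: J_def f'_def)
    then have "continuous_map P ?I (\<lambda>y. y f')"
      unfolding P_def by (rule continuous_map_product_projection)
    then have "continuous_map T ?I (\<lambda>y. y f')"
      by (simp add: T_def continuous_map_from_subtopology)
    moreover have "e x f' = f x" if "x \<in> topspace S" for x
      using \<open>f' \<in> J\<close> that by (simp add: e_def f'_def)
    ultimately show ?thesis by blast
  qed
  ultimately show ?thesis unfolding stone_cech_def by blast
qed

end

(* A set and its trace on a dense subset have the same closure, so hat S T e B is the interior of the
   closure of the image of B; hence hatting is monotone and commutes with intersections. Compactness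
   then makes the limit set of an ultrafilter s nonempty. If x is a limit of s, every B with x in
   hat S T e B lies in s, since otherwise some A in s is disjoint from B and x would not be in the
   closure of hat S T e A. As the sets hat S T e B form a base and T is regular, this gives both
   uniqueness of limits and continuity. A point x is the limit of any ultrafilter that extends
   the filter of all B with x in hat S T e B. *)
theory Submission
  imports Defs
begin

section \<open>Ultrafilters\<close>

text \<open>Zorn's lemma for the proper filters containing \<open>F\<close>. The union of a nonempty
  chain is again such a filter, since any two of its members already lie in a common filter of the
  chain.\<close>

lemma proper_filter_extends_to_ultrafilter:
  assumes "proper_filter_of \<BB> F"
  obtains s where "ultrafilter_of \<BB> s" "F \<subseteq> s"
proof -
  define \<F> where "\<F> = {G. proper_filter_of \<BB> G \<and> F \<subseteq> G}"
  have "F \<in> \<F>"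
    using assms by (simp add: \<F>_def)
  moreover have "\<Union>\<C> \<in> \<F>" if ne: "\<C> \<noteq> {}" and ch: "subset.chain \<F> \<C>" for \<C>
  proof -
    have pf: "proper_filter_of \<BB> G" "F \<subseteq> G" if "G \<in> \<C>" for G
      using ch that by (auto simp: subset.chain_def \<F>_def)
    have "A \<inter> B \<in> \<Union>\<C>" if AB: "A \<in> \<Union>\<C>" "B \<in> \<Union>\<C>" for A B
    proof -
      obtain G H where GH: "G \<in> \<C>" "H \<in> \<C>" "A \<in> G" "B \<in> H"
        using AB by blast
      then have "G \<subseteq> H \<or> H \<subseteq> G"
        using ch by (auto simp: subset_chain_def)
      then obtain K where "K \<in> \<C>" "A \<in> K" "B \<in> K"
        using GH by blast
      then show ?thesis
        using pf unfolding proper_filter_of_def by blast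
    qed
    moreover have "G \<subseteq> \<BB>" "{} \<notin> G" if "G \<in> \<C>" for G
      using pf(1)[OF that] by (simp_all add: proper_filter_of_def)
    then have "\<Union>\<C> \<subseteq> \<BB>" "{} \<notin> \<Union>\<C>"
      by blast+
    moreover have F_sub: "F \<subseteq> \<Union>\<C>"
      using pf(2) ne by blast
    moreover have "\<Union>\<C> \<noteq> {}"
      using F_sub assms unfolding proper_filter_of_def by (metis subset_empty)
    moreover have "B \<in> \<Union>\<C>" if "A \<in> \<Union>\<C>" "B \<in> \<BB>" "A \<subseteq> B" for A B
      using pf(1) that by (meson UnionE UnionI proper_filter_of_def)
    ultimately have "proper_filter_of \<BB> (\<Union>\<C>)"
      unfolding proper_filter_of_def by blast
    then show ?thesis
      using F_sub by (simp add: \<F>_def)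
  qed
  ultimately obtain s where "s \<in> \<F>" "\<forall>G\<in>\<F>. s \<subseteq> G \<longrightarrow> G = s"
    using subset_Zorn_nonempty[of \<F>] by blast
  then have "ultrafilter_of \<BB> s" "F \<subseteq> s"
    unfolding \<F>_def ultrafilter_of_def by blast+
  then show ?thesis
    using that by blast
qed

text \<open>If \<open>B\<close> met every member of \<open>s\<close>, then \<open>s\<close> and
  \<open>B\<close> would generate a proper filter strictly larger than \<open>s\<close>, against
  maximality.\<close>

lemma ultrafilter_disjoint_member:
  assumes Int: "\<And>A B. A \<in> \<BB> \<Longrightarrow> B \<in> \<BB> \<Longrightarrow> A \<inter> B \<in> \<BB>"
    and s: "ultrafilter_of \<BB> s" and B: "B \<in> \<BB>" "B \<notin> s"
  shows "\<exists>A\<in>s. A \<inter> B = {}"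
proof (rule ccontr)
  assume no: "\<not> (\<exists>A\<in>s. A \<inter> B = {})"
  have s': "s \<subseteq> \<BB>" "s \<noteq> {}" "\<And>A C. A \<in> s \<Longrightarrow> C \<in> s \<Longrightarrow> A \<inter> C \<in> s"
    using s by (auto simp: ultrafilter_of_def proper_filter_of_def)
  \<comment> \<open>The filter generated by \<open>s\<close> and \<open>B\<close>; it is proper
    exactly because no member of \<open>s\<close> is disjoint from \<open>B\<close>.\<close>
  define G where "G = {C \<in> \<BB>. \<exists>A\<in>s. A \<inter> B \<subseteq> C}"
  have sG: "s \<subseteq> G" and BG: "B \<in> G"
    using s' B(1) by (auto simp: G_def)
  have "C \<inter> D \<in> G" if CD: "C \<in> G" "D \<in> G" for C D
  proof -
    obtain A A' where "A \<in> s" "A' \<in> s" "A \<inter> B \<subseteq> C" "A' \<inter> B \<subseteq> D"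
      using CD by (auto simp: G_def)
    then have "A \<inter> A' \<in> s" "(A \<inter> A') \<inter> B \<subseteq> C \<inter> D"
      using s'(3) by auto
    then show ?thesis
      using that Int by (auto simp: G_def)
  qed
  moreover have "{} \<notin> G"
    using no by (auto simp: G_def)
  moreover have "D \<in> G" if "C \<in> G" "D \<in> \<BB>" "C \<subseteq> D" for C D
    using that by (auto simp: G_def)
  ultimately have "proper_filter_of \<BB> G"
    using BG by (auto simp: proper_filter_of_def G_def)
  then show False
    using s sG BG B(2) by (auto simp: ultrafilter_of_def)
qed

section \<open>Extensions of regular open sets\<close>

text \<open>These facts replace the definite description behind \<open>hat\<close> by an explicit
  formula, from which its order properties can be read off.\<close>

lemma
  assumes sc: "stone_cech S T e" and A: "A \<in> regular_opens S"
  shows openin_hat: "openin T (hat S T e A)"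
    and hat_Int_image: "hat S T e A \<inter> e ` topspace S = e ` A"
    and closure_of_hat: "T closure_of (hat S T e A) = T closure_of (e ` A)"
    and hat_eq: "hat S T e A = T interior_of (T closure_of (e ` A))"
proof -
  have reg: "hat S T e A \<in> regular_opens T" "trace_on S e (hat S T e A) = A"
    using hat_characterization[OF assms] by auto
  show op: "openin T (hat S T e A)"
    using reg by (simp add: regular_opens_def)
  show img: "hat S T e A \<inter> e ` topspace S = e ` A"
    using reg(2) by (auto simp: trace_on_def)
  show cl: "T closure_of (hat S T e A) = T closure_of (e ` A)"
    using closure_of_open_Int_dense[of T "e ` topspace S" "hat S T e A"] op img sc
    by (simp add: stone_cech_def)
  show "hat S T e A = T interior_of (T closure_of (e ` A))"
    using reg(1) cl by (simp add: regular_opens_def)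
qed

lemma hat_mono:
  assumes "stone_cech S T e" "A \<in> regular_opens S" "B \<in> regular_opens S" "A \<subseteq> B"
  shows "hat S T e A \<subseteq> hat S T e B"
  using assms by (simp add: hat_eq interior_of_mono closure_of_mono image_mono)

text \<open>Injectivity of \<open>e\<close> makes the image of \<open>A \<inter> B\<close> the trace
  of an open set on a dense set, and an open set lies in the closure of such a trace. With the
  closure on the right, the bound serves both for intersections of hats and for
  disjointness.\<close>

lemma hat_Int_subset_closure:
  assumes sc: "stone_cech S T e" and A: "A \<in> regular_opens S" and B: "B \<in> regular_opens S"
  shows "hat S T e A \<inter> hat S T e B \<subseteq> T closure_of (e ` (A \<inter> B))"
proof -
  let ?O = "hat S T e A \<inter> hat S T e B"
  have op: "openin T ?O"
    using assms by (simp add: openin_hat openin_Int)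
  have "inj_on e (topspace S)"
    using sc by (auto simp: stone_cech_def embedding_map_def homeomorphic_eq_everything_map)
  moreover have "A \<subseteq> topspace S" "B \<subseteq> topspace S"
    using A B by (auto simp: regular_opens_def dest: openin_subset)
  ultimately have "e ` (A \<inter> B) = e ` A \<inter> e ` B"
    by (rule inj_on_image_Int)
  also have "\<dots> = ?O \<inter> e ` topspace S"
    unfolding hat_Int_image[OF sc A, symmetric] hat_Int_image[OF sc B, symmetric] by auto
  finally have "?O \<inter> e ` topspace S = e ` (A \<inter> B)" ..
  moreover have "T closure_of (e ` topspace S) = topspace T"
    using sc by (simp add: stone_cech_def)
  ultimately have "T closure_of ?O = T closure_of (e ` (A \<inter> B))"
    using closure_of_open_Int_dense op by metis
  then show ?thesis
    using op by (metis closure_of_subset openin_subset)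
qed

lemma hat_Int:
  assumes "stone_cech S T e" "A \<in> regular_opens S" "B \<in> regular_opens S"
    and "A \<inter> B \<in> regular_opens S"
  shows "hat S T e (A \<inter> B) = hat S T e A \<inter> hat S T e B"
proof
  \<comment> \<open>The left side is open and lies in the closure of the image of
    \<open>A \<inter> B\<close>, hence in the interior of that closure.\<close>
  show "hat S T e A \<inter> hat S T e B \<subseteq> hat S T e (A \<inter> B)"
    using assms hat_Int_subset_closure[of S T e A B]
    by (metis hat_eq interior_of_maximal openin_Int openin_hat)
qed (use assms in \<open>simp add: hat_mono\<close>)

text \<open>Disjoint sets have disjoint hats, and an open set disjoint from another set also misses
  its closure.\<close>

lemma disjnt_hat_closure:
  assumes "stone_cech S T e" "A \<in> regular_opens S" "B \<in> regular_opens S" "A \<inter> B = {}"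
  shows "hat S T e A \<inter> T closure_of (hat S T e B) = {}"
proof -
  have "hat S T e A \<inter> hat S T e B = {}"
    using hat_Int_subset_closure[of S T e A B] assms by simp
  then show ?thesis
    using openin_Int_closure_of_eq_empty openin_hat assms by metis
qed

lemma generative_base:
  assumes "generative S T e \<BB>" "openin T U" "x \<in> U"
  obtains B where "B \<in> \<BB>" "x \<in> hat S T e B" "hat S T e B \<subseteq> U"
proof -
  have "openin T = arbitrary union_of (\<lambda>U. U \<in> hat S T e ` \<BB>)"
    using assms(1) by (simp only: generative_def)
  then have "(arbitrary union_of (\<lambda>U. U \<in> hat S T e ` \<BB>)) U"
    using assms(2) by metis
  then obtain \<U> where "\<U> \<subseteq> hat S T e ` \<BB>" "\<Union>\<U> = U"
    unfolding union_of_def arbitrary_def by blast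
  then show ?thesis
    using that assms(3) by blast
qed

section \<open>Limit points\<close>

text \<open>By the finite intersection property: finitely many members of \<open>s\<close> share a
  point of \<open>S\<close>, whose image under \<open>e\<close> lies in all the corresponding
  closures.\<close>

lemma limit_set_nonempty:
  assumes sc: "stone_cech S T e" and sub: "\<BB> \<subseteq> regular_opens S"
    and s: "proper_filter_of \<BB> s"
  shows "limit_set S T e s \<noteq> {}"
proof -
  have comp: "compact_space T"
    using sc by (simp add: stone_cech_def)
  have s': "s \<subseteq> \<BB>" "s \<noteq> {}" "{} \<notin> s" "\<And>A C. A \<in> s \<Longrightarrow> C \<in> s \<Longrightarrow> A \<inter> C \<in> s"
    using s by (auto simp: proper_filter_of_def)
  \<comment> \<open>The empty family is excluded because its intersection is \<open>UNIV\<close>,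
    which need not belong to \<open>s\<close>.\<close>
  have fin: "\<Inter>\<A> \<in> s" if "finite \<A>" "\<A> \<noteq> {}" "\<A> \<subseteq> s" for \<A>
    using that by (induction rule: finite_ne_induct) (auto simp: s')
  let ?c = "\<lambda>B. T closure_of (hat S T e B)"
  have "\<Inter>(?c ` s) \<noteq> {}"
  proof (rule compact_space_fip[THEN iffD1, OF comp, rule_format])
    show "(\<forall>C\<in>?c ` s. closedin T C) \<and> (\<forall>\<F>. finite \<F> \<and> \<F> \<subseteq> ?c ` s \<longrightarrow> \<Inter>\<F> \<noteq> {})"
    proof (intro conjI allI impI)
      fix \<F> assume "finite \<F> \<and> \<F> \<subseteq> ?c ` s"
      then obtain \<A> where \<A>: "finite \<A>" "\<A> \<subseteq> s" "\<F> = ?c ` \<A>"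
        by (metis finite_subset_image)
      show "\<Inter>\<F> \<noteq> {}"
      proof (cases "\<A> = {}")
        case False
        then have "\<Inter>\<A> \<noteq> {}"
          using fin[OF \<A>(1) _ \<A>(2)] s'(3) by metis
        then obtain z where z: "z \<in> \<Inter>\<A>"
          by blast
        have "e z \<in> ?c B" if "B \<in> \<A>" for B
        proof -
          have B: "B \<in> regular_opens S" "z \<in> B"
            using that \<A> s'(1) sub z by auto
          then have "e z \<in> hat S T e B"
            using hat_Int_image[OF sc B(1)] by blast
          then show ?thesis
            using closure_of_subset[OF openin_subset[OF openin_hat[OF sc B(1)]]] by blast
        qed
        then show ?thesis
          using \<A>(3) by blast
      qed (simp add: \<A>)
    qed auto
  qed
  then show ?thesis by (simp add: limit_set_def)
qed

text \<open>This turns a basic neighbourhood of a limit into a member of the ultrafilter; uniqueness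
  and continuity both rest on it.\<close>

lemma limit_set_hat_mem:
  assumes sc: "stone_cech S T e" and alg: "boolean_subalgebra S \<BB>" and s: "ultrafilter_of \<BB> s"
    and x: "x \<in> limit_set S T e s" "x \<in> hat S T e B" and B: "B \<in> \<BB>"
  shows "B \<in> s"
proof (rule ccontr)
  assume "B \<notin> s"
  have sub: "\<BB> \<subseteq> regular_opens S" and Int: "\<And>A B. A \<in> \<BB> \<Longrightarrow> B \<in> \<BB> \<Longrightarrow> A \<inter> B \<in> \<BB>"
    using alg by (auto simp: boolean_subalgebra_def)
  obtain A where A: "A \<in> s" "A \<inter> B = {}"
    using ultrafilter_disjoint_member[OF Int s B \<open>B \<notin> s\<close>] by blast
  then have "A \<in> \<BB>"
    using s by (auto simp: ultrafilter_of_def proper_filter_of_def)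
  then have "hat S T e B \<inter> T closure_of (hat S T e A) = {}"
    using disjnt_hat_closure[OF sc, of B A] sub B A(2) by blast
  then show False
    using x A(1) by (auto simp: limit_set_def)
qed

text \<open>Separate \<open>x\<close> from \<open>y\<close> by disjoint open sets. A basic
  neighbourhood of \<open>x\<close> inside the first comes from a member of \<open>s\<close>, so its
  closure must contain \<open>y\<close>, which the second open set forbids.\<close>

lemma limit_set_unique:
  assumes sc: "stone_cech S T e" and alg: "boolean_subalgebra S \<BB>" and gen: "generative S T e \<BB>"
    and s: "ultrafilter_of \<BB> s" and x: "x \<in> limit_set S T e s" and y: "y \<in> limit_set S T e s"
  shows "x = y"
proof (rule ccontr)
  assume "x \<noteq> y"
  \<comment> \<open>For an empty \<open>s\<close> the limit set would be \<open>UNIV\<close>; a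
    single member confines it to \<open>topspace T\<close>.\<close>
  have "s \<noteq> {}"
    using s by (auto simp: ultrafilter_of_def proper_filter_of_def)
  then have "x \<in> topspace T" "y \<in> topspace T"
    using x y closure_of_subset_topspace[of T] by (auto simp: limit_set_def)
  with \<open>x \<noteq> y\<close> obtain U V where UV: "openin T U" "openin T V" "x \<in> U" "y \<in> V" "disjnt U V"
    using sc unfolding stone_cech_def Hausdorff_space_def by metis
  obtain B where B: "B \<in> \<BB>" "x \<in> hat S T e B" "hat S T e B \<subseteq> U"
    using generative_base[OF gen UV(1,3)] .
  have "B \<in> s"
    using limit_set_hat_mem[OF sc alg s x B(2,1)] .
  then have "y \<in> T closure_of (hat S T e B)"
    using y by (simp add: limit_set_def)
  then show False
    using UV(2,4,5) B(3) unfolding in_closure_of disjnt_iff by blast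
qed

lemma limit_set_surj:
  assumes sc: "stone_cech S T e" and alg: "boolean_subalgebra S \<BB>" and gen: "generative S T e \<BB>"
    and x: "x \<in> topspace T"
  obtains s where "ultrafilter_of \<BB> s" "x \<in> limit_set S T e s"
proof -
  have sub: "\<BB> \<subseteq> regular_opens S" and Int: "\<And>A B. A \<in> \<BB> \<Longrightarrow> B \<in> \<BB> \<Longrightarrow> A \<inter> B \<in> \<BB>"
    using alg by (auto simp: boolean_subalgebra_def)
  define F where "F = {B \<in> \<BB>. x \<in> hat S T e B}"
  have "F \<noteq> {}"
    using generative_base[OF gen openin_topspace x] by (auto simp: F_def)
  moreover have "{} \<notin> F"
    \<comment> \<open>The formula for \<open>hat\<close> gives the empty set for \<open>{}\<close>,
      so it cannot contain \<open>x\<close>.\<close>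
    using sub hat_eq[OF sc, of "{}"] by (auto simp: F_def)
  moreover have "A \<inter> B \<in> F" if "A \<in> F" "B \<in> F" for A B
    using that hat_Int[OF sc, of A B] sub Int[of A B] by (auto simp: F_def)
  moreover have "B \<in> F" if "A \<in> F" "B \<in> \<BB>" "A \<subseteq> B" for A B
    using that hat_mono[OF sc, of A B] sub by (auto simp: F_def)
  ultimately have "proper_filter_of \<BB> F"
    by (auto simp: proper_filter_of_def F_def)
  then obtain s where s: "ultrafilter_of \<BB> s" "F \<subseteq> s"
    using proper_filter_extends_to_ultrafilter by blast
  \<comment> \<open>Every basic neighbourhood of \<open>x\<close> comes from some \<open>C\<close>
    in \<open>F\<close>, hence in \<open>s\<close>. So \<open>C \<inter> B\<close> is a nonempty
    member of \<open>s\<close>, and the image of any of its points lies in both hats.\<close>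
  have "x \<in> T closure_of (hat S T e B)" if B: "B \<in> s" for B
  proof -
    have "\<exists>y. y \<in> hat S T e B \<and> y \<in> U" if U: "openin T U" "x \<in> U" for U
    proof -
      obtain C where C: "C \<in> \<BB>" "x \<in> hat S T e C" "hat S T e C \<subseteq> U"
        using generative_base[OF gen U] .
      then have "C \<in> s"
        using s(2) by (auto simp: F_def)
      then have "C \<inter> B \<in> s" "{} \<notin> s" and "B \<in> \<BB>"
        using s(1) B by (auto simp: ultrafilter_of_def proper_filter_of_def)
      then have "C \<inter> B \<noteq> {}"
        by metis
      then obtain z where z: "z \<in> C" "z \<in> B" by blast
      have "e z \<in> hat S T e C" "e z \<in> hat S T e B"
        using z hat_Int_image[OF sc, of C] hat_Int_image[OF sc, of B] sub C(1) \<open>B \<in> \<BB>\<close> by blast+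
      then show ?thesis
        using C(3) by blast
    qed
    then show ?thesis
      using x by (auto simp: in_closure_of)
  qed
  then show ?thesis
    using that s(1) by (auto simp: limit_set_def)
qed

theorem proposition8p3:
  fixes S :: "'a topology" and T :: "'b topology" and e :: "'a \<Rightarrow> 'b" and \<BB> :: "'a set set"
  assumes "locally_compact_space S" and "Hausdorff_space S"
    and "stone_cech S T e"
    and "boolean_subalgebra S \<BB>" and "generative S T e \<BB>"
  shows "(\<forall>s \<in> topspace (stone_space \<BB>). \<exists>!x. x \<in> limit_set S T e s) \<and>
         continuous_map (stone_space \<BB>) T (limit_point S T e) \<and>
         limit_point S T e ` topspace (stone_space \<BB>) = topspace T"
proof -
  note sc = assms(3) and alg = assms(4) and gen = assms(5)
  let ?p = "limit_point S T e"
  have sub: "\<BB> \<subseteq> regular_opens S"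
    using alg by (simp add: boolean_subalgebra_def)
  have top: "topspace (stone_space \<BB>) = {s. ultrafilter_of \<BB> s}"
    using topspace_stone_space[OF alg] .
  have ex1: "\<exists>!x. x \<in> limit_set S T e s" if "ultrafilter_of \<BB> s" for s
    using limit_set_nonempty[OF sc sub, of s] limit_set_unique[OF sc alg gen that] that
    unfolding ultrafilter_of_def by blast
  have p: "?p s \<in> limit_set S T e s" if "ultrafilter_of \<BB> s" for s
    using theI'[OF ex1[OF that]] by (simp add: limit_point_def)
  have p_in: "?p s \<in> topspace T" if s: "ultrafilter_of \<BB> s" for s
  proof -
    have "s \<noteq> {}"
      using s by (auto simp: ultrafilter_of_def proper_filter_of_def)
    then show ?thesis
      using p[OF s] closure_of_subset_topspace[of T] by (auto simp: limit_set_def)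
  qed
  have reg: "regular_space T"
    using sc by (simp add: stone_cech_def compact_Hausdorff_imp_regular_space)
  have "continuous_map (stone_space \<BB>) T ?p"
    unfolding continuous_map_def
  proof (intro conjI allI impI)
    show "?p \<in> topspace (stone_space \<BB>) \<rightarrow> topspace T"
      using p_in by (auto simp: top)
    fix U assume U: "openin T U"
    let ?V = "{s \<in> topspace (stone_space \<BB>). ?p s \<in> U}"
    have "\<exists>W. openin (stone_space \<BB>) W \<and> s \<in> W \<and> W \<subseteq> ?V" if "s \<in> ?V" for s
    proof -
      have s: "ultrafilter_of \<BB> s" "?p s \<in> U"
        using that by (auto simp: top)
      \<comment> \<open>Regularity of \<open>T\<close> leaves room for a closure: membership in
        \<open>s\<close> controls the limit only up to the closure of a hat, so that closure must
        still fit inside \<open>U\<close>.\<close>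
      obtain O' K where O': "openin T O'" "closedin T K" "?p s \<in> O'" "O' \<subseteq> K" "K \<subseteq> U"
        using reg U s(2) unfolding neighbourhood_base_of_closedin[symmetric] neighbourhood_base_of
        by metis
      obtain B where B: "B \<in> \<BB>" "?p s \<in> hat S T e B" "hat S T e B \<subseteq> O'"
        using generative_base[OF gen O'(1,3)] .
      have "T closure_of (hat S T e B) \<subseteq> U"
        using B(3) O' closure_of_minimal[of "hat S T e B" K T] by blast
      \<comment> \<open>Any ultrafilter containing \<open>B\<close> has its limit in the closure of
        the hat of \<open>B\<close>, by definition of the limit set.\<close>
      then have "stone_basic \<BB> B \<subseteq> ?V"
        using p by (auto simp: stone_basic_def top limit_set_def)
      moreover have "s \<in> stone_basic \<BB> B"
        using limit_set_hat_mem[OF sc alg s(1) p[OF s(1)] B(2,1)] s(1)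
        by (simp add: stone_basic_def)
      moreover have "openin (stone_space \<BB>) (stone_basic \<BB> B)"
        using B(1) by (simp add: openin_stone_space[OF alg] arbitrary_union_of_inc)
      ultimately show ?thesis by blast
    qed
    then show "openin (stone_space \<BB>) ?V"
      using openin_subopen by blast
  qed
  moreover have "topspace T \<subseteq> ?p ` topspace (stone_space \<BB>)"
  proof
    fix x assume "x \<in> topspace T"
    then obtain s where s: "ultrafilter_of \<BB> s" "x \<in> limit_set S T e s"
      using limit_set_surj[OF sc alg gen] by blast
    then have "x = ?p s"
      using ex1 p by blast
    then show "x \<in> ?p ` topspace (stone_space \<BB>)"
      using s(1) by (simp add: top)
  qed
  ultimately show ?thesis
    using ex1 p_in by (auto simp: top)
qed

end
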